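(* Let $G$ be a cubic graph, let $\widehat{\Pi}$ be a base embedding of $G$, and let $\Pi$ be an embedding of $G$ with $\Pi$-unstable set $U_\Pi$ and $\Pi$-unstable cut $\delta(U_\Pi)=E(U_\Pi,V(G)\setminus U_\Pi)$ with respect to $\widehat{\Pi}$. Let $H_1,H_2,\dots,H_\gamma$ be the $\Pi$-unstable components (the connected components of $G[U_\Pi]$), and for $i=1,\dots,\gamma$ let $c_i=|E(V(H_i),V(G)\setminus V(H_i))|$. Then $$g(\Pi)\le g(\widehat{\Pi})+\left\lfloor\frac{c_1-1}{2}\right\rfloor+\left\lfloor\frac{c_2-1}{2}\right\rfloor+\dots+\left\lfloor\frac{c_\gamma-1}{2}\right\rfloor.$$
   Context: $G$ is a finite connected graph. All embeddings are 2-cell embeddings in closed orientable surfaces and are described by rotation systems: an embedding $\Pi$ assigns to each vertex $v$ a clockwise cyclic ordering $\pi_v$ of the edges incident with $v$. $g(\Pi)$ is the genus of the surface of $\Pi$. Fix a base embedding $\widehat{\Pi}$ with local rotations $\widehat{\pi}_v$. A vertex $v$ is $\Pi$-unstable (with respect to $\widehat{\Pi}$) if $\pi_v\neq\widehat{\pi}_v$, and $U_\Pi$ is the set of $\Pi$-unstable vertices. For $X\subseteq V(G)$, $E(X,V(G)\setminus X)$ denotes the set of edges with exactly one endpoint in $X$, and $G[X]$ is the subgraph induced by $X$.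
   Formalization: The formal theorem assumes that not every vertex is unstable; if all are, then γ = 1, c₁ = 0 and the floor is −1, while Π is the mirror image of the base embedding with equal genus, so the stated inequality fails. *)

theory Defs
  imports "Graph_Theory.Graph_Theory" "HOL-Combinatorics.Orbits"
begin

text \<open>
  A finite undirected graph (parallel edges and loops allowed) is a finite bidirected digraph
  \<open>G\<close> with arc reversal \<open>arev\<close>: an edge is a pair \<open>{a, arev a}\<close> of mutually reverse arcs, and the
  edge ends at a vertex \<open>v\<close> are the arcs with tail \<open>v\<close>. A loop contributes two arcs at its vertex,
  so \<open>out_degree\<close> is the usual degree.
\<close>

definition cubic :: "('a, 'b) pre_digraph \<Rightarrow> bool" where
  "cubic G \<longleftrightarrow> (\<forall>v\<in>verts G. out_degree G v = 3)"

definition edges :: "('a, 'b) pre_digraph \<Rightarrow> ('b \<Rightarrow> 'b) \<Rightarrow> 'b set set" where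
  "edges G arev = {{a, arev a} | a. a \<in> arcs G}"

definition edges_between ::
  "('a, 'b) pre_digraph \<Rightarrow> ('b \<Rightarrow> 'b) \<Rightarrow> 'a set \<Rightarrow> 'a set \<Rightarrow> 'b set set" where
  "edges_between G arev X Y = {{a, arev a} | a. a \<in> arcs G \<and> tail G a \<in> X \<and> head G a \<in> Y}"

definition components :: "('a, 'b) pre_digraph \<Rightarrow> ('a, 'b) pre_digraph set" where
  "components G = {H. pre_digraph.max_subgraph G Digraph_Component.connected H}"

text \<open>
  A 2-cell embedding in a closed oriented surface, given as a rotation system: \<open>\<pi> v\<close> sends each
  edge end at \<open>v\<close> to its clockwise successor. It is the identity away from \<open>v\<close>, so that two local
  rotations at \<open>v\<close> agree iff they are equal as functions. Isolated vertices are excluded.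
\<close>

definition embedding :: "('a, 'b) pre_digraph \<Rightarrow> ('a \<Rightarrow> 'b \<Rightarrow> 'b) \<Rightarrow> bool" where
  "embedding G \<pi> \<longleftrightarrow>
     (\<forall>v\<in>verts G. \<pi> v permutes out_arcs G v \<and> cyclic_on (\<pi> v) (out_arcs G v))"

text \<open>
  Face tracing: after traversing \<open>a\<close>, which arrives at \<open>head G a\<close> along the end \<open>arev a\<close>,
  continue with the successor of that end. The facial walks are the orbits.
\<close>

definition face_succ ::
  "('a, 'b) pre_digraph \<Rightarrow> ('b \<Rightarrow> 'b) \<Rightarrow> ('a \<Rightarrow> 'b \<Rightarrow> 'b) \<Rightarrow> 'b \<Rightarrow> 'b" where
  "face_succ G arev \<pi> a = \<pi> (head G a) (arev a)"

definition faces ::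
  "('a, 'b) pre_digraph \<Rightarrow> ('b \<Rightarrow> 'b) \<Rightarrow> ('a \<Rightarrow> 'b \<Rightarrow> 'b) \<Rightarrow> 'b set set" where
  "faces G arev \<pi> = orbit (face_succ G arev \<pi>) ` arcs G"

definition euler_char ::
  "('a, 'b) pre_digraph \<Rightarrow> ('b \<Rightarrow> 'b) \<Rightarrow> ('a \<Rightarrow> 'b \<Rightarrow> 'b) \<Rightarrow> int" where
  "euler_char G arev \<pi> =
     int (card (verts G)) - int (card (edges G arev)) + int (card (faces G arev \<pi>))"

text \<open>
  Genus of the surface of a connected embedded graph, by Euler's formula \<open>V - E + F = 2 - 2g\<close>.
  The Euler characteristic is even for every rotation system, so the division is exact.
\<close>

definition genus ::
  "('a, 'b) pre_digraph \<Rightarrow> ('b \<Rightarrow> 'b) \<Rightarrow> ('a \<Rightarrow> 'b \<Rightarrow> 'b) \<Rightarrow> int" where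
  "genus G arev \<pi> = (2 - euler_char G arev \<pi>) div 2"

definition unstable ::
  "('a, 'b) pre_digraph \<Rightarrow> ('a \<Rightarrow> 'b \<Rightarrow> 'b) \<Rightarrow> ('a \<Rightarrow> 'b \<Rightarrow> 'b) \<Rightarrow> 'a set" where
  "unstable G \<pi>0 \<pi> = {v \<in> verts G. \<pi> v \<noteq> \<pi>0 v}"

end

theory Submission
  imports Defs
begin

text \<open>
  In a cubic graph the two rotations possible at a vertex are inverse to each other, so
  \<open>\<Pi>\<close> arises from the base embedding by reversing all rotations on one unstable
  component after the other. Let \<open>X\<close> be such a component, with a cut of
  \<open>c\<close> edges. Reversal keeps the faces that avoid the cut, up to orientation. A face
  that meets the cut has to leave \<open>X\<close> along some cut edge, and each cut edge is
  traversed outwards by exactly one face, so at most \<open>c\<close> faces are destroyed. At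
  least one face meeting the cut exists afterwards, since \<open>c \<ge> 1\<close> by
  connectedness. Thus at most \<open>c - 1\<close> faces are lost. This number is even: the face
  permutation is the arc reversal followed by a product of 3-cycles, so its sign, and with it the
  parity of the number of faces, does not depend on the embedding. Hence the genus grows by at
  most \<open>\<lfloor>(c - 1) / 2\<rfloor>\<close>.
\<close>

section \<open>Sign and number of orbits\<close>

text \<open>The composite fixes \<open>a\<close> and sends the preimage of \<open>a\<close> straight
  to \<open>p a\<close>: one cycle skips \<open>a\<close>, the others are unchanged. This is the
  induction step for the sign formula.\<close>

lemma orbit_bypass:
  assumes p: "p permutes insert a A" and a: "a \<notin> A" "p a \<noteq> a" and x: "x \<in> A"
  shows "orbit (transpose a (p a) \<circ> p) x = orbit p x - {a}"
proof -
  define q where "q = transpose a (p a) \<circ> p"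
  have q: "q permutes A"
    unfolding q_def using p by (rule permutes_insert_lemma)
  have inj: "p y = p a \<longleftrightarrow> y = a" for y
    using permutes_inj[OF p] by (auto dest: injD)
  have q_eq: "q y = (if p y = a then p a else p y)" if "y \<noteq> a" for y
    using that by (auto simp: q_def transpose_def inj)
  have not_a: "y \<noteq> a" if "y \<in> orbit q x" for y
    using permutes_orbit_subset[OF q x] that a by auto
  have x_a: "x \<noteq> a"
    using x a by auto
  have "y \<in> orbit p x" if "y \<in> orbit q x" for y
    using that
  proof induction
    case base
    then show ?case
      using q_eq[OF x_a] by (auto intro: orbit_eqI)
  next
    case (step y)
    then show ?case
      using q_eq[OF not_a[OF step.hyps]] by (auto intro: orbit_eqI)
  qed
  \<comment> \<open>The second conjunct carries the induction across \<open>a\<close>, which no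
    \<open>q\<close>-orbit in \<open>A\<close> contains: there the point after it is recorded
    instead.\<close>
  moreover have "(y \<noteq> a \<longrightarrow> y \<in> orbit q x) \<and> (y = a \<longrightarrow> p a \<in> orbit q x)"
    if "y \<in> orbit p x" for y
    using that
  proof induction
    case base
    then show ?case
      using q_eq[OF x_a] orbit.base[of q x] by auto
  next
    case (step y)
    then show ?case
      using q_eq[of y] orbit.step[of y q x] a by (cases "y = a") auto
  qed
  ultimately show ?thesis
    using not_a unfolding q_def by blast
qed

text \<open>A cycle of length k is a product of k - 1 transpositions, and fixed points in
  \<open>A\<close> count as orbits. The exponent is a sum because only the parity of the difference
  matters. In the induction a fixed \<open>a\<close> adds one point and one orbit; otherwise
  bypassing \<open>a\<close> costs one transposition and keeps the number of orbits.\<close>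

lemma sign_conv_card_orbits:
  assumes "finite A" "p permutes A"
  shows "sign p = (-1) ^ (card A + card (orbit p ` A))"
  using assms
proof (induction A arbitrary: p rule: finite_induct)
  case empty
  then show ?case
    by (simp add: permutes_empty)
next
  case (insert a A)
  have perm: "permutation p"
    using insert.prems insert.hyps by (auto simp: permutation_permutes)
  show ?case
  proof (cases "p a = a")
    case True
    then have p: "p permutes A"
      using insert.prems by (metis (full_types) permutes_superset Diff_iff insert_iff)
    have "orbit p a = {a}"
      using True by (simp add: orbit_eq_singleton_iff)
    moreover have "orbit p a \<notin> orbit p ` A"
    proof
      assume "orbit p a \<in> orbit p ` A"
      then obtain b where "b \<in> A" "orbit p a = orbit p b"
        by auto
      then have "a \<in> A"
        using permutes_orbit_subset[OF p] \<open>orbit p a = {a}\<close> by auto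
      then show False
        using insert.hyps by simp
    qed
    ultimately show ?thesis
      using insert.IH[OF p] insert.hyps by (simp add: card_insert_if)
  next
    case False
    define q where "q = transpose a (p a) \<circ> p"
    have q: "q permutes A"
      unfolding q_def using insert.prems by (rule permutes_insert_lemma)
    have "sign q = - sign p"
      using False perm unfolding q_def
      by (subst sign_compose) (auto simp: permutation_swap_id sign_swap_id)
    moreover have "card (orbit q ` A) = card (orbit p ` insert a A)"
    proof -
      have "p a \<in> A"
        using False permutes_in_image[OF insert.prems, of a] by auto
      then have "orbit p ` insert a A = orbit p ` A"
        using permutation_orbit_step[OF perm, of a] by (metis image_insert insert_absorb)
      moreover have "(\<lambda>B. B - {a}) ` orbit p ` A = orbit q ` A"
        unfolding image_image q_def
        using insert False by (intro image_cong refl) (simp add: orbit_bypass)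
      \<comment> \<open>Each of these orbits contains a point other than \<open>a\<close>, and that
        point determines the orbit.\<close>
      moreover have "inj_on (\<lambda>B. B - {a}) (orbit p ` A)"
      proof (rule inj_onI)
        fix B C
        assume B: "B \<in> orbit p ` A" and C: "C \<in> orbit p ` A" and eq: "B - {a} = C - {a}"
        then obtain b c where bc: "b \<in> A" "B = orbit p b" "c \<in> A" "C = orbit p c"
          by auto
        then have "b \<in> orbit p b" "b \<noteq> a"
          using permutation_self_in_orbit[OF perm] insert.hyps by auto
        then have "b \<in> orbit p c"
          using eq bc by auto
        then show "B = C"
          using bc cyclic_on_orbit'[OF perm, of c] by (auto simp: cyclic_on_alldef)
      qed
      ultimately show ?thesis
        by (metis card_image)
    qed
    ultimately show ?thesis
      using insert.IH[OF q] insert.hyps by simp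
  qed
qed

section \<open>Rotations at vertices of degree three\<close>

lemma three_cycle_cases:
  assumes "p permutes {a, b, c}" "cyclic_on p {a, b, c}" "a \<noteq> b" "b \<noteq> c" "a \<noteq> c"
  shows "p a = b \<and> p b = c \<and> p c = a \<or> p a = c \<and> p b = a \<and> p c = b"
proof -
  have "card {a, b, c} \<noteq> 1"
    using assms(3-5) by simp
  then have "p y \<in> {a, b, c} \<and> p y \<noteq> y" if "y \<in> {a, b, c}" for y
    using eq_on_cyclic_on_iff1[OF assms(2) that] by metis
  from this[of a] this[of b] this[of c]
  have "p a = b \<or> p a = c" "p b = a \<or> p b = c" "p c = a \<or> p c = b"
    by auto
  moreover have "p a \<noteq> p b" "p b \<noteq> p c" "p a \<noteq> p c"
    using assms(3-5) permutes_inj[OF assms(1)] by (auto dest: injD)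
  ultimately show ?thesis
    by metis
qed

lemma three_cycle_cube:
  assumes "p permutes S" "cyclic_on p S" "card S = 3"
  shows "p (p (p x)) = x"
proof (cases "x \<in> S")
  case True
  obtain a b c where S: "S = {a, b, c}" "a \<noteq> b" "b \<noteq> c" "a \<noteq> c"
    using assms(3) by (auto simp: card_3_iff)
  then have "p a = b \<and> p b = c \<and> p c = a \<or> p a = c \<and> p b = a \<and> p c = b"
    using assms three_cycle_cases by metis
  moreover have "x = a \<or> x = b \<or> x = c"
    using True S by simp
  ultimately show ?thesis
    by (elim disjE conjE) simp_all
next
  case False
  then show ?thesis
    using assms(1) by (simp add: permutes_not_in)
qed

text \<open>Three points admit only two cyclic orders, each the reverse of the other. This is why an
  unstable vertex of a cubic graph carries the reversed base rotation.\<close>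

lemma three_cycles_inverse:
  assumes p: "p permutes S" "cyclic_on p S" and q: "q permutes S" "cyclic_on q S"
    and S: "card S = 3" and "p \<noteq> q"
  shows "p (q x) = x"
proof (cases "x \<in> S")
  case True
  obtain a b c where S': "S = {a, b, c}" "a \<noteq> b" "b \<noteq> c" "a \<noteq> c"
    using S by (auto simp: card_3_iff)
  have cases: "p a = b \<and> p b = c \<and> p c = a \<or> p a = c \<and> p b = a \<and> p c = b"
    "q a = b \<and> q b = c \<and> q c = a \<or> q a = c \<and> q b = a \<and> q c = b"
    using p q S' three_cycle_cases by metis+
  have differ: "\<not> (p a = q a \<and> p b = q b \<and> p c = q c)"
  proof
    assume *: "p a = q a \<and> p b = q b \<and> p c = q c"
    have "p y = q y" for y
    proof (cases "y \<in> S")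
      case True
      then show ?thesis
        using * S' by blast
    next
      case False
      then show ?thesis
        using p(1) q(1) by (simp add: permutes_not_in)
    qed
    then show False
      using \<open>p \<noteq> q\<close> by auto
  qed
  have "x = a \<or> x = b \<or> x = c"
    using True S' by simp
  then show ?thesis
    using cases differ by (elim disjE conjE) simp_all
next
  case False
  then show ?thesis
    using p q by (simp add: permutes_not_in)
qed

section \<open>Face tracing in cubic graphs\<close>

locale cubic_graph = fin_digraph G + bidirected_digraph G arev
  for G :: "('a, 'b) pre_digraph" and arev :: "'b \<Rightarrow> 'b" +
  assumes cubic: "cubic G"
begin

text \<open>All local rotations assembled into one map on arcs, so that signs can be
  computed.\<close>

definition rotation :: "('a \<Rightarrow> 'b \<Rightarrow> 'b) \<Rightarrow> 'b \<Rightarrow> 'b" where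
  "rotation \<pi> a = (if a \<in> arcs G then \<pi> (tail G a) a else a)"

text \<open>
  Unlike \<^const>\<open>face_succ\<close>, which is arbitrary outside \<^term>\<open>arcs G\<close>, this is a permutation.
\<close>
definition face_perm :: "('a \<Rightarrow> 'b \<Rightarrow> 'b) \<Rightarrow> 'b \<Rightarrow> 'b" where
  "face_perm \<pi> = rotation \<pi> \<circ> arev"

lemma embedding_at:
  assumes "embedding G \<pi>" "a \<in> arcs G"
  shows "\<pi> (tail G a) permutes out_arcs G (tail G a)"
    "cyclic_on (\<pi> (tail G a)) (out_arcs G (tail G a))"
    "card (out_arcs G (tail G a)) = 3"
  using assms cubic by (auto simp: embedding_def cubic_def out_degree_def)

lemma rotation_in:
  assumes "embedding G \<pi>" "a \<in> arcs G"
  shows "rotation \<pi> a \<in> arcs G" "tail G (rotation \<pi> a) = tail G a"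
proof -
  have "\<pi> (tail G a) a \<in> out_arcs G (tail G a)"
    using permutes_in_image[OF embedding_at(1)[OF assms], of a] assms(2) by simp
  then show "rotation \<pi> a \<in> arcs G" "tail G (rotation \<pi> a) = tail G a"
    using assms(2) by (auto simp: rotation_def)
qed

lemma rotation_cube:
  assumes "embedding G \<pi>"
  shows "rotation \<pi> (rotation \<pi> (rotation \<pi> a)) = a"
proof (cases "a \<in> arcs G")
  case True
  have eq: "rotation \<pi> b = \<pi> (tail G a) b" if "b \<in> arcs G" "tail G b = tail G a" for b
    using that by (simp add: rotation_def)
  note in1 = rotation_in[OF assms True]
  note in2 = rotation_in[OF assms in1(1)]
  have "rotation \<pi> (rotation \<pi> (rotation \<pi> a))
      = \<pi> (tail G a) (\<pi> (tail G a) (\<pi> (tail G a) a))"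
    using eq[OF in2(1) trans[OF in2(2) in1(2)]] eq[OF in1] eq[OF True refl] by metis
  then show ?thesis
    using three_cycle_cube[OF embedding_at[OF assms True]] by simp
qed (simp add: rotation_def)

lemma rotation_permutes:
  assumes "embedding G \<pi>"
  shows "rotation \<pi> permutes arcs G"
proof (rule bij_imp_permutes)
  \<comment> \<open>A map whose cube is the identity is bijective, with its square as
    inverse.\<close>
  have cube: "rotation \<pi> \<circ> (rotation \<pi> \<circ> rotation \<pi>) = id"
    by (simp add: fun_eq_iff rotation_cube[OF assms])
  then have "bij (rotation \<pi>)"
    by (metis comp_assoc o_bij)
  then show "bij_betw (rotation \<pi>) (arcs G) (arcs G)"
    by (intro bij_betwI[where g = "rotation \<pi> \<circ> rotation \<pi>"])
      (auto simp: rotation_in[OF assms] rotation_cube[OF assms])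
qed (simp add: rotation_def)

text \<open>The cube is the identity, so the sign is a cube root of 1 among 1 and -1.\<close>

lemma sign_rotation:
  assumes "embedding G \<pi>"
  shows "sign (rotation \<pi>) = 1"
proof -
  have perm: "permutation (rotation \<pi>)"
    by (rule permutes_imp_permutation[OF finite_arcs rotation_permutes[OF assms]])
  have "rotation \<pi> \<circ> (rotation \<pi> \<circ> rotation \<pi>) = id"
    by (simp add: fun_eq_iff rotation_cube[OF assms])
  then have "sign (rotation \<pi>) * (sign (rotation \<pi>) * sign (rotation \<pi>)) = 1"
    using perm by (metis permutation_compose sign_compose sign_id)
  then show ?thesis
    by simp
qed

lemma face_perm_permutes:
  assumes "embedding G \<pi>"
  shows "face_perm \<pi> permutes arcs G"
  unfolding face_perm_def
  using arev_permutes_arcs rotation_permutes[OF assms] by (rule permutes_compose)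

lemma permutation_face_perm:
  assumes "embedding G \<pi>"
  shows "permutation (face_perm \<pi>)"
  by (rule permutes_imp_permutation[OF finite_arcs face_perm_permutes[OF assms]])

lemma face_perm_in:
  assumes "embedding G \<pi>" "a \<in> arcs G"
  shows "face_perm \<pi> a \<in> arcs G" "tail G (face_perm \<pi> a) = head G a"
  using assms rotation_in[OF assms(1), of "arev a"] by (auto simp: face_perm_def)

lemma faces_conv_orbits:
  assumes "embedding G \<pi>"
  shows "faces G arev \<pi> = orbit (face_perm \<pi>) ` arcs G"
  unfolding faces_def
proof (rule image_cong[OF refl])
  fix a assume "a \<in> arcs G"
  then show "orbit (face_succ G arev \<pi>) a = orbit (face_perm \<pi>) a"
    using face_perm_in[OF assms]
    by (intro orbit_cong0[symmetric, where A = "arcs G"])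
      (auto simp: face_perm_def rotation_def face_succ_def)
qed

lemma even_card_faces_iff:
  assumes "embedding G \<pi>0" "embedding G \<pi>"
  shows "even (card (faces G arev \<pi>)) \<longleftrightarrow> even (card (faces G arev \<pi>0))"
proof -
  \<comment> \<open>The right-hand side does not mention the embedding.\<close>
  have "(-1) ^ (card (arcs G) + card (faces G arev \<pi>)) = sign arev"
    if "embedding G \<pi>" for \<pi>
  proof -
    have "permutation (rotation \<pi>)" "permutation arev"
      by (rule permutes_imp_permutation[OF finite_arcs rotation_permutes[OF that]])
        (rule permutes_imp_permutation[OF finite_arcs arev_permutes_arcs])
    then have "sign (face_perm \<pi>) = sign arev"
      by (simp add: face_perm_def sign_compose sign_rotation[OF that])
    then show ?thesis
      using sign_conv_card_orbits[OF finite_arcs face_perm_permutes[OF that]]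
      by (simp add: faces_conv_orbits[OF that])
  qed
  from this[OF assms(1)] this[OF assms(2)]
  have "(-1 :: int) ^ (card (arcs G) + card (faces G arev \<pi>))
      = (-1) ^ (card (arcs G) + card (faces G arev \<pi>0))"
    by simp
  then show ?thesis
    by (simp add: minus_one_power_iff split: if_splits)
qed

section \<open>Reversing all rotations in a vertex set\<close>

definition out_cut :: "'a set \<Rightarrow> 'b set" where
  "out_cut X = {a \<in> arcs G. tail G a \<in> X \<and> head G a \<notin> X}"

text \<open>Both orientations of every cut edge: a face can meet the cut in either direction, while
  \<open>out_cut\<close> has one arc per edge.\<close>

definition cut_arcs :: "'a set \<Rightarrow> 'b set" where
  "cut_arcs X = {a \<in> arcs G. tail G a \<in> X \<longleftrightarrow> head G a \<notin> X}"

lemma card_edges_between: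
  "card (edges_between G arev X (verts G - X)) = card (out_cut X)"
proof -
  have "edges_between G arev X (verts G - X) = (\<lambda>a. {a, arev a}) ` out_cut X"
    by (auto simp: edges_between_def out_cut_def)
  moreover have "inj_on (\<lambda>a. {a, arev a}) (out_cut X)"
    by (rule inj_onI) (auto simp: out_cut_def doubleton_eq_iff)
  ultimately show ?thesis
    by (simp add: card_image)
qed

lemma orbit_face_perm_subset:
  assumes "embedding G \<pi>" "a \<in> arcs G"
  shows "orbit (face_perm \<pi>) a \<subseteq> arcs G"
  using face_perm_permutes[OF assms(1)] assms(2) by (rule permutes_orbit_subset)

text \<open>A face that enters \<open>X\<close> has to leave it again.\<close>
lemma face_meets_out_cut:
  assumes \<pi>: "embedding G \<pi>" and a: "a \<in> arcs G" and meets: "orbit (face_perm \<pi>) a \<inter> cut_arcs X \<noteq> {}"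
  shows "orbit (face_perm \<pi>) a \<in> orbit (face_perm \<pi>) ` out_cut X"
proof -
  let ?f = "face_perm \<pi>"
  obtain b where b: "b \<in> orbit ?f a" "b \<in> cut_arcs X"
    using meets by auto
  have orb: "orbit ?f c = orbit ?f a" if "c \<in> orbit ?f a" for c
    using cyclic_on_orbit'[OF permutation_face_perm[OF \<pi>], of a] that
    by (simp add: cyclic_on_alldef)
  have "\<exists>c \<in> orbit ?f a. c \<in> out_cut X"
  proof (rule ccontr)
    assume none: "\<not> ?thesis"
    \<comment> \<open>A cut arc that does not leave \<open>X\<close> enters it. From there on the
      walk would stay in \<open>X\<close>, yet the orbit returns to \<open>b\<close>, whose tail
      lies outside.\<close>
    have b': "b \<in> arcs G" "tail G b \<notin> X" "head G b \<in> X"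
      using b none by (auto simp: cut_arcs_def out_cut_def)
    have "c \<in> arcs G \<and> tail G c \<in> X" if "c \<in> orbit ?f b" for c
      using that
    proof induction
      case base
      then show ?case
        using b' face_perm_in[OF \<pi>] by simp
    next
      case (step c)
      then have "head G c \<in> X"
        using none orb[OF b(1)] by (auto simp: out_cut_def)
      then show ?case
        using step face_perm_in[OF \<pi>] by simp
    qed
    then show False
      using b' permutation_self_in_orbit[OF permutation_face_perm[OF \<pi>], of b] by auto
  qed
  then show ?thesis
    using orb by blast
qed

text \<open>The head of an arc is the tail of its successor on the face, so a face changes sides
  only along a cut arc.\<close>

lemma face_avoiding_cut:
  assumes \<pi>: "embedding G \<pi>" and a: "a \<in> arcs G" and avoids: "orbit (face_perm \<pi>) a \<inter> cut_arcs X = {}"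
    and b: "b \<in> orbit (face_perm \<pi>) a"
  shows "tail G b \<in> X \<longleftrightarrow> tail G a \<in> X"
  using b
proof induction
  case base
  have "a \<notin> cut_arcs X"
    using avoids permutation_self_in_orbit[OF permutation_face_perm[OF \<pi>], of a] by auto
  then show ?case
    using a face_perm_in[OF \<pi>] by (auto simp: cut_arcs_def)
next
  case (step b)
  then have "b \<in> arcs G" "b \<notin> cut_arcs X"
    using avoids orbit_face_perm_subset[OF \<pi> a] by auto
  then show ?case
    using step face_perm_in[OF \<pi>] by (auto simp: cut_arcs_def)
qed

text \<open>
  The faces that do not cross the cut survive the reversal: outside \<open>X\<close> they are unchanged, inside
  \<open>X\<close> they are traversed backwards.
\<close>
lemma card_faces_avoiding_cut_le:
  assumes \<pi>0: "embedding G \<pi>0" and \<pi>: "embedding G \<pi>" and X: "X = unstable G \<pi>0 \<pi>"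
  shows "card {F \<in> faces G arev \<pi>0. F \<inter> cut_arcs X = {}} \<le> card {F \<in> faces G arev \<pi>. F \<inter> cut_arcs X = {}}"
proof -
  \<comment> \<open>Taking images under \<open>\<theta>\<close> will carry surviving faces of
    \<open>\<pi>0\<close> to faces of \<open>\<pi>\<close>. Cut arcs are left out for injectivity:
    an arc leaving \<open>X\<close> and its reverse have the same image.\<close>
  define \<theta> where "\<theta> a = (if tail G a \<in> X then arev a else a)" for a
  let ?g = "face_perm \<pi>0" and ?f = "face_perm \<pi>"
  have inj: "inj_on \<theta> (arcs G - cut_arcs X)"
    by (rule inj_onI) (auto simp: \<theta>_def cut_arcs_def arev_eq_iff split: if_splits)
  have sub: "{F \<in> faces G arev \<pi>0. F \<inter> cut_arcs X = {}} \<subseteq> Pow (arcs G - cut_arcs X)"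
    using orbit_face_perm_subset[OF \<pi>0] by (auto simp: faces_conv_orbits[OF \<pi>0])
  have "\<theta> ` orbit ?g a \<in> {F \<in> faces G arev \<pi>. F \<inter> cut_arcs X = {}}"
    if a: "a \<in> arcs G" "orbit ?g a \<inter> cut_arcs X = {}" for a
  proof -
    have arcs: "b \<in> arcs G" "b \<notin> cut_arcs X" "tail G b \<in> X \<longleftrightarrow> tail G a \<in> X" if "b \<in> orbit ?g a" for b
      using that a orbit_face_perm_subset[OF \<pi>0 a(1)] face_avoiding_cut[OF \<pi>0 a that] by auto
    have a_orb: "a \<in> orbit ?g a"
      by (rule permutation_self_in_orbit[OF permutation_face_perm[OF \<pi>0]])
    have "\<exists>b \<in> arcs G. \<theta> ` orbit ?g a = orbit ?f b"
    proof (cases "tail G a \<in> X")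
      case True
      \<comment> \<open>At the unstable vertex \<open>head G b\<close> the rotation of
        \<open>\<pi>\<close> undoes that of \<open>\<pi>0\<close>. Hence \<open>arev\<close> turns
        steps of \<open>?g\<close> into backward steps of \<open>?f\<close>, and a permutation and
        its inverse have the same orbits.\<close>
      have "inv ?f (arev b) = arev (?g b)" if b: "b \<in> orbit ?g a" for b
      proof -
        have in_X: "b \<in> arcs G" "head G b \<in> X"
          using arcs[OF b] True by (auto simp: cut_arcs_def)
        let ?c = "arev b"
        have c: "?c \<in> arcs G" "tail G ?c \<in> X" "tail G ?c \<in> verts G"
          using in_X by auto
        have "\<pi> (tail G ?c) (\<pi>0 (tail G ?c) ?c) = ?c"
          using c X by (intro three_cycles_inverse[OF embedding_at(1,2)[OF \<pi> c(1)]
                embedding_at[OF \<pi>0 c(1)]]) (auto simp: unstable_def)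
        then have "rotation \<pi> (rotation \<pi>0 ?c) = ?c"
          using rotation_in[OF \<pi>0 c(1)] c(1) by (simp add: rotation_def)
        then have "?f (arev (?g b)) = arev b"
          by (simp add: face_perm_def)
        then show ?thesis
          by (metis face_perm_permutes[OF \<pi>] permutes_inverses(2))
      qed
      then have "arev ` orbit ?g a = orbit (inv ?f) (arev a)"
        using a_orb by (intro orbit_inverse) auto
      moreover have "\<theta> ` orbit ?g a = arev ` orbit ?g a"
        using arcs True by (intro image_cong) (auto simp: \<theta>_def)
      ultimately show ?thesis
        using a(1) orbit_inv_eq[OF permutation_face_perm[OF \<pi>]] by (auto intro!: bexI[of _ "arev a"])
    next
      case False
      \<comment> \<open>The head of \<open>b\<close> is also outside \<open>X\<close>, hence
        stable.\<close>
      have "?f b = ?g b" if b: "b \<in> orbit ?g a" for b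
        using arcs[OF b] False X
        by (auto simp: face_perm_def rotation_def cut_arcs_def unstable_def)
      then have "orbit ?f a = orbit ?g a"
        using a_orb by (intro orbit_cong) auto
      moreover have "\<theta> ` orbit ?g a = id ` orbit ?g a"
        using arcs False by (intro image_cong) (auto simp: \<theta>_def)
      ultimately show ?thesis
        using a(1) by auto
    qed
    moreover have "\<theta> ` orbit ?g a \<inter> cut_arcs X = {}"
      using arcs by (auto simp: \<theta>_def cut_arcs_def)
    ultimately show ?thesis
      by (auto simp: faces_conv_orbits[OF \<pi>])
  qed
  then have "image \<theta> ` {F \<in> faces G arev \<pi>0. F \<inter> cut_arcs X = {}} \<subseteq> {F \<in> faces G arev \<pi>. F \<inter> cut_arcs X = {}}"
    by (auto simp: faces_conv_orbits[OF \<pi>0])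
  moreover have "finite {F \<in> faces G arev \<pi>. F \<inter> cut_arcs X = {}}"
    by (simp add: faces_def)
  ultimately show ?thesis
    by (rule card_inj_on_le[OF inj_on_subset[OF inj_on_image_Pow[OF inj] sub]])
qed

lemma genus_reverse_le:
  assumes \<pi>0: "embedding G \<pi>0" and \<pi>: "embedding G \<pi>" and ne: "out_cut (unstable G \<pi>0 \<pi>) \<noteq> {}"
  shows "genus G arev \<pi> \<le> genus G arev \<pi>0 + (int (card (out_cut (unstable G \<pi>0 \<pi>))) - 1) div 2"
proof -
  define X where "X = unstable G \<pi>0 \<pi>"
  define meet where "meet \<rho> = {F \<in> faces G arev \<rho>. F \<inter> cut_arcs X \<noteq> {}}" for \<rho>
  define avoid where "avoid \<rho> = {F \<in> faces G arev \<rho>. F \<inter> cut_arcs X = {}}" for \<rho>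
  have fin: "finite (faces G arev \<rho>)" for \<rho>
    by (simp add: faces_def)
  have split: "card (faces G arev \<rho>) = card (meet \<rho>) + card (avoid \<rho>)" for \<rho>
    unfolding meet_def avoid_def using fin
    by (subst card_Un_disjoint[symmetric]) (auto intro: arg_cong[where f = card])
  have "meet \<pi>0 \<subseteq> orbit (face_perm \<pi>0) ` out_cut X"
    using face_meets_out_cut[OF \<pi>0] by (auto simp: meet_def faces_conv_orbits[OF \<pi>0])
  then have "card (meet \<pi>0) \<le> card (out_cut X)"
    by (rule surj_card_le[rotated]) (simp add: out_cut_def)
  \<comment> \<open>The face of \<open>\<pi>\<close> through any cut arc; it accounts for the -1 in
    the bound.\<close>
  moreover have "1 \<le> card (meet \<pi>)"
  proof -
    obtain a where "a \<in> out_cut X"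
      using ne X_def by auto
    then have "orbit (face_perm \<pi>) a \<in> meet \<pi>"
      using permutation_self_in_orbit[OF permutation_face_perm[OF \<pi>], of a]
      by (auto simp: meet_def faces_conv_orbits[OF \<pi>] out_cut_def cut_arcs_def)
    moreover have "finite (meet \<pi>)"
      using fin by (simp add: meet_def)
    ultimately show ?thesis
      by (metis One_nat_def Suc_leI card_gt_0_iff empty_iff)
  qed
  moreover have "card (avoid \<pi>0) \<le> card (avoid \<pi>)"
    unfolding avoid_def by (rule card_faces_avoiding_cut_le[OF \<pi>0 \<pi> X_def])
  ultimately have "int (card (faces G arev \<pi>0)) - int (card (faces G arev \<pi>)) \<le> int (card (out_cut X)) - 1"
    using split[of \<pi>0] split[of \<pi>] by linarith
  \<comment> \<open>The face loss is 2k, at most c - 1 for a cut of c edges. Shifting the numerator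
    by 2k changes the quotient by 2 by exactly k, and k is at most (c - 1) div 2.\<close>
  moreover have "even (int (card (faces G arev \<pi>0)) - int (card (faces G arev \<pi>)))"
    using even_card_faces_iff[OF \<pi>0 \<pi>] by simp
  then obtain k where "int (card (faces G arev \<pi>0)) - int (card (faces G arev \<pi>)) = 2 * k"
    by (rule evenE)
  ultimately show ?thesis
    unfolding X_def[symmetric] genus_def euler_char_def by presburger
qed

end

section \<open>Components\<close>

text \<open>Connectedness is strong connectedness of the symmetric closure. Symmetrization commutes
  with union, and strongly connected digraphs with a common vertex have a strongly connected
  union.\<close>

lemma connected_union:
  assumes "wf_digraph G" "wf_digraph H" "compatible G H"
    and "Digraph_Component.connected G" "Digraph_Component.connected H"
    and "verts G \<inter> verts H \<noteq> {}"
  shows "Digraph_Component.connected (Digraph_Component.union G H)"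
proof -
  have "strongly_connected (Digraph_Component.union (with_proj (mk_symmetric G)) (with_proj (mk_symmetric H)))"
    using assms unfolding Digraph_Component.connected_def
    by (intro strongly_connected_non_disj)
      (auto simp: wf_digraph_wp_iff intro: wf_digraph.wellformed_mk_symmetric)
  moreover have "Digraph_Component.union (with_proj (mk_symmetric G)) (with_proj (mk_symmetric H))
      = with_proj (mk_symmetric (Digraph_Component.union G H))"
    using assms(3) by (auto simp: Digraph_Component.union_def parcs_mk_symmetric compatible_def)
  ultimately show ?thesis
    by (simp add: Digraph_Component.connected_def)
qed

text \<open>The union of two components that meet is a connected subgraph containing both, so
  maximality makes it equal to each.\<close>

lemma components_disjoint:
  assumes "H \<in> components G" "K \<in> components G" "H \<noteq> K"
  shows "verts H \<inter> verts K = {}"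
proof (rule ccontr)
  assume meet: "verts H \<inter> verts K \<noteq> {}"
  have sub: "subgraph H G" "subgraph K G"
    and conn: "Digraph_Component.connected H" "Digraph_Component.connected K"
    using assms by (auto simp: components_def pre_digraph.max_subgraph_def)
  then have wf: "wf_digraph H" "wf_digraph K" and comp: "compatible H K"
    by (auto simp: subgraph_def compatible_def)
  let ?U = "Digraph_Component.union H K"
  have "subgraph H ?U" "subgraph K ?U"
    using subgraphs_of_union[OF wf comp] by auto
  moreover have "subgraph ?U G"
    using sub comp by (auto simp: compatible_def intro!: subgraph_union)
  moreover have "Digraph_Component.connected ?U"
    using connected_union[OF wf comp conn meet] .
  ultimately have "?U = H" "?U = K"
    using assms by (auto simp: components_def pre_digraph.max_subgraph_def)
  then show False
    using assms(3) by simp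
qed

lemma verts_component_nonempty:
  assumes "H \<in> components G"
  shows "verts H \<noteq> {}"
  using assms
  by (auto simp: components_def pre_digraph.max_subgraph_def Digraph_Component.connected_def
      strongly_connected_def)

text \<open>Components have disjoint nonempty vertex sets and so are determined by them.\<close>

lemma finite_components:
  assumes "fin_digraph G"
  shows "finite (components G)"
proof (rule inj_on_finite)
  show "inj_on verts (components G)"
    by (rule inj_onI) (metis Int_absorb components_disjoint verts_component_nonempty)
  show "verts ` components G \<subseteq> Pow (verts G)"
    by (auto simp: components_def pre_digraph.max_subgraph_def subgraph_def)
  show "finite (Pow (verts G))"
    using assms by (simp add: fin_digraph.finite_verts)
qed

lemma Union_verts_components:
  assumes "fin_digraph G"
  shows "(\<Union>H \<in> components G. verts H) = verts G"
proof
  show "(\<Union>H \<in> components G. verts H) \<subseteq> verts G"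
    by (auto simp: components_def pre_digraph.max_subgraph_def subgraph_def)
  show "verts G \<subseteq> (\<Union>H \<in> components G. verts H)"
  proof
    fix u assume u: "u \<in> verts G"
    interpret fin_digraph G
      by fact
    define P where "P H \<longleftrightarrow> subgraph H G \<and> Digraph_Component.connected H \<and> u \<in> verts H" for H
    \<comment> \<open>A largest connected subgraph through \<open>u\<close> is a component: a proper
      extension has the same tail and head maps, so it must add a vertex or an arc. The search
      starts from the single vertex \<open>u\<close>.\<close>
    let ?size = "\<lambda>H :: ('a, 'b) pre_digraph. card (verts H) + card (arcs H)"
    let ?H0 = "\<lparr>verts = {u}, arcs = {}, tail = tail G, head = head G\<rparr>"
    have "P ?H0"
      using u unfolding P_def
      by (auto simp: subgraph_def compatible_def wf_digraph_def wf_digraph_axioms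
          Digraph_Component.connected_def strongly_connected_def reachable_def
          mk_symmetric_def)
    moreover have bound: "?size H \<le> card (verts G) + card (arcs G)" if "P H" for H
      using that by (auto simp: P_def subgraph_def intro!: add_mono card_mono)
    ultimately have "\<exists>H. P H \<and> (\<forall>K. P K \<longrightarrow> ?size K \<le> ?size H)"
      by (intro ex_has_greatest_nat[where b = "Suc (card (verts G) + card (arcs G))"])
        (auto simp: less_Suc_eq_le)
    then obtain H where H: "P H" and max: "\<forall>K. P K \<longrightarrow> ?size K \<le> ?size H"
      by (elim exE conjE)
    have "max_subgraph Digraph_Component.connected H"
    proof (rule max_subgraphI)
      fix K assume K: "H \<noteq> K" "subgraph H K" "subgraph K G"
      show "\<not> Digraph_Component.connected K"
      proof
        assume "Digraph_Component.connected K"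
        then have "P K"
          using H K by (auto simp: P_def subgraph_def)
        then have le: "?size K \<le> ?size H"
          by (rule max[rule_format])
        interpret K: fin_digraph K
          using K(3) by (rule fin_digraph_subgraph)
        have "verts H \<subseteq> verts K" "arcs H \<subseteq> arcs K"
          using K by (auto simp: subgraph_def)
        then have "card (verts H) \<le> card (verts K)" "card (arcs H) \<le> card (arcs K)"
          by (auto intro: card_mono)
        then have "card (verts H) = card (verts K)" "card (arcs H) = card (arcs K)"
          using le by auto
        then have "verts H = verts K" "arcs H = arcs K"
          using \<open>verts H \<subseteq> verts K\<close> \<open>arcs H \<subseteq> arcs K\<close>
            card_subset_eq[OF K.finite_verts] card_subset_eq[OF K.finite_arcs] by blast+
        then show False
          using K by (auto simp: subgraph_def compatible_def)
      qed
    qed (use H in \<open>auto simp: P_def\<close>)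
    then show "u \<in> (\<Union>H \<in> components G. verts H)"
      using H by (auto simp: P_def components_def)
  qed
qed

section \<open>Reversing one unstable component after another\<close>

context cubic_graph
begin

text \<open>The reverse of an arc entering \<open>X\<close> leaves \<open>X\<close>. With no leaving
  arc, \<open>X\<close> would be closed under adjacency and \<open>u\<close> could not reach
  \<open>v\<close>.\<close>

lemma out_cut_nonempty:
  assumes conn: "Digraph_Component.connected G" and X: "X \<subseteq> verts G" "X \<noteq> {}" "X \<noteq> verts G"
  shows "out_cut X \<noteq> {}"
proof
  assume none: "out_cut X = {}"
  obtain u v where uv: "u \<in> X" "v \<in> verts G" "v \<notin> X"
    using X by auto
  have closed: "w' \<in> X" if ww': "(w, w') \<in> parcs (mk_symmetric G)" and w: "w \<in> X" for w w'
  proof (rule ccontr)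
    assume "w' \<notin> X"
    obtain a where "a \<in> arcs G" "(w, w') = (tail G a, head G a) \<or> (w, w') = (head G a, tail G a)"
      using ww' by (auto simp: parcs_mk_symmetric)
    then have "a \<in> out_cut X \<or> arev a \<in> out_cut X"
      using w \<open>w' \<notin> X\<close> by (auto simp: out_cut_def)
    then show False
      using none by simp
  qed
  have "u \<rightarrow>\<^sup>*\<^bsub>with_proj (mk_symmetric G)\<^esub> v"
    using conn uv X by (auto simp: Digraph_Component.connected_def strongly_connected_def)
  then have "(u, v) \<in> (parcs (mk_symmetric G))\<^sup>*"
    by (auto simp: reachable_def intro: rtrancl_on_rtranclI)
  then have "v \<in> X"
    by (induction rule: rtrancl_induct) (auto intro: uv(1) closed)
  then show False
    using uv by simp
qed

text \<open>The embedding switches from \<open>\<pi>0\<close> to \<open>\<pi>\<close> on one set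
  \<open>V i\<close> at a time. Each step is a reversal whose unstable set, relative to the previous
  embedding, is exactly \<open>V i\<close>.\<close>

lemma genus_reverse_family_le:
  assumes conn: "Digraph_Component.connected G" and \<pi>0: "embedding G \<pi>0" and \<pi>: "embedding G \<pi>"
    and U: "unstable G \<pi>0 \<pi> \<noteq> verts G"
    and "finite I" "\<And>i. i \<in> I \<Longrightarrow> V i \<noteq> {} \<and> V i \<subseteq> unstable G \<pi>0 \<pi>"
    and "\<And>i j. i \<in> I \<Longrightarrow> j \<in> I \<Longrightarrow> i \<noteq> j \<Longrightarrow> V i \<inter> V j = {}"
  shows "genus G arev (\<lambda>v. if v \<in> (\<Union>i\<in>I. V i) then \<pi> v else \<pi>0 v)
    \<le> genus G arev \<pi>0 + (\<Sum>i\<in>I. (int (card (out_cut (V i))) - 1) div 2)"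
  using assms(5-7)
proof (induction I rule: finite_induct)
  case empty
  then show ?case
    by simp
next
  case (insert i I)
  define \<rho> where "\<rho> I v = (if v \<in> (\<Union>i\<in>I. V i) then \<pi> v else \<pi>0 v)" for I v
  have emb: "embedding G (\<rho> J)" for J
    using \<pi>0 \<pi> by (auto simp: embedding_def \<rho>_def)
  have V: "V i \<noteq> {}" "V i \<subseteq> unstable G \<pi>0 \<pi>"
    using insert.prems by auto
  have "V i \<inter> V j = {}" if "j \<in> I" for j
    using insert.prems(2)[of i j] insert.hyps that by auto
  then have "unstable G (\<rho> I) (\<rho> (insert i I)) = V i"
    using V by (auto simp: unstable_def \<rho>_def)
  \<comment> \<open>A stable vertex exists, so \<open>V i\<close> is a proper subset of the
    vertices.\<close>
  moreover have "out_cut (V i) \<noteq> {}"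
    using V U by (intro out_cut_nonempty[OF conn]) (auto simp: unstable_def)
  ultimately have "genus G arev (\<rho> (insert i I))
      \<le> genus G arev (\<rho> I) + (int (card (out_cut (V i))) - 1) div 2"
    using genus_reverse_le[OF emb emb, of I "insert i I"] by simp
  moreover have "genus G arev (\<rho> I)
      \<le> genus G arev \<pi>0 + (\<Sum>i\<in>I. (int (card (out_cut (V i))) - 1) div 2)"
    using insert.IH insert.prems unfolding \<rho>_def by simp
  ultimately show ?case
    using insert.hyps unfolding \<rho>_def by simp
qed

text \<open>\<open>embedding\<close> leaves the values away from \<open>verts G\<close> free, so
  embeddings agreeing at all vertices may differ as functions.\<close>

lemma genus_cong:
  assumes "\<And>v. v \<in> verts G \<Longrightarrow> \<pi> v = \<rho> v" "embedding G \<pi>" "embedding G \<rho>"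
  shows "genus G arev \<pi> = genus G arev \<rho>"
proof -
  have "face_perm \<pi> = face_perm \<rho>"
    using assms(1) by (auto simp: face_perm_def rotation_def fun_eq_iff)
  then show ?thesis
    using assms by (simp add: genus_def euler_char_def faces_conv_orbits)
qed

end

text \<open>If every vertex were unstable, \<open>\<pi>\<close> would be the mirror image of
  \<open>\<pi>0\<close>, of equal genus, while the single component \<open>G\<close> with its empty
  cut would contribute -1. The last assumption excludes this case.\<close>

theorem theorem4p1:
  fixes G :: "('a, 'b) pre_digraph" and arev :: "'b \<Rightarrow> 'b"
    and \<pi>0 \<pi> :: "'a \<Rightarrow> 'b \<Rightarrow> 'b"
  assumes "fin_digraph G" and "bidirected_digraph G arev"
    and "Digraph_Component.connected G"
    and "cubic G"
    and "embedding G \<pi>0"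
    and "embedding G \<pi>"
    and "unstable G \<pi>0 \<pi> \<noteq> verts G"
  shows "genus G arev \<pi> \<le> genus G arev \<pi>0 +
    (\<Sum>H\<in>components (G \<restriction> unstable G \<pi>0 \<pi>).
       \<lfloor>(real (card (edges_between G arev (verts H) (verts G - verts H))) - 1) / 2\<rfloor>)"
proof -
  interpret fin_digraph G
    by fact
  interpret bidirected_digraph G arev
    by fact
  interpret cubic_graph G arev
    by unfold_locales fact
  let ?U = "unstable G \<pi>0 \<pi>"
  let ?C = "components (G \<restriction> ?U)"
  have U: "?U \<subseteq> verts G"
    by (auto simp: unstable_def)
  then have "induced_subgraph (G \<restriction> ?U) G"
    by (rule induced_induce)
  then have fin: "fin_digraph (G \<restriction> ?U)"
    by (intro fin_digraph_subgraph induced_imp_subgraph)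
  have cover: "(\<Union>H\<in>?C. verts H) = ?U"
    using Union_verts_components[OF fin] by simp
  \<comment> \<open>Integer \<open>div\<close> rounds down, so this also holds for the numerator
    -1.\<close>
  have floor: "\<lfloor>(real n - 1) / 2\<rfloor> = (int n - 1) div 2" for n
    using floor_divide_of_int_eq[of "int n - 1" 2, where ?'a = real] by simp
  let ?\<rho> = "\<lambda>v. if v \<in> (\<Union>H\<in>?C. verts H) then \<pi> v else \<pi>0 v"
  have "genus G arev \<pi> = genus G arev ?\<rho>"
  proof (rule genus_cong)
    show "\<pi> v = ?\<rho> v" if "v \<in> verts G" for v
      using that unfolding cover by (simp add: unstable_def)
    show "embedding G ?\<rho>"
      using assms(5,6) by (auto simp: embedding_def)
  qed fact
  also have "\<dots> \<le> genus G arev \<pi>0 + (\<Sum>H\<in>?C. (int (card (out_cut (verts H))) - 1) div 2)"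
    using assms(3,5-7) finite_components[OF fin] verts_component_nonempty components_disjoint cover
    by (intro genus_reverse_family_le) blast+
  finally show ?thesis
    by (simp add: card_edges_between floor)
qed

end
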